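(* Let $\langle A,S,P,(\lhd_a)_{a\in A}\rangle$ be an abstract strategic game. Assume that each $\lhd_a$ is a strict partial order, i.e. irreflexive and transitive. For each agent $a$ and each $\gamma\in\Sigma_{-a}$ define the following subset of $S_a$: $$BR_a(\gamma)=\Big\{s\in S_a \;\Big|\; \big(\forall s'\in S_a,\ \neg(s\lhd_a^{S_{-a}}s')\big)\wedge\big(\forall s'\in S_a,\ \neg(s\lhd_a^{\gamma}s')\big)\wedge\big(\exists c\in\gamma,\ \forall s'\in S_a,\ \neg(s\lhd_a^{\{c\}}s')\big)\Big\}.$$ Then $\langle (S_a)_{a\in A},(BR_a)_{a\in A}\rangle$ is an ndbr multi strategic game (i.e. $BR_a(\gamma)$ is a non-empty subset of $S_a$ for all $a\in A$ and $\gamma\in\Sigma_{-a}$), and it has an ndbr equilibrium, i.e. there exists $\sigma\in\Sigma$ such that $\sigma_a\subseteq BR_a(\sigma_{-a})$ for every $a\in A$.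
   Context: An abstract strategic game is a 4-tuple $\langle A,S,P,(\lhd_a)_{a\in A}\rangle$ where $A$ is a non-empty set of agents, $S=\prod_{a\in A}S_a$ is a Cartesian product of non-empty sets of individual strategies, $P:S\to Oc$ maps strategy profiles to outcomes, and each $\lhd_a$ is a binary relation over $Oc$ ($oc\lhd_a oc'$ means that agent $a$ prefers $oc'$ over $oc$). Put $S_{-a}=\prod_{a'\neq a}S_{a'}$, $\Sigma_a=\mathcal{P}(S_a)\setminus\{\emptyset\}$, $\Sigma=\prod_{a\in A}\Sigma_a$, $\Sigma_{-a}=\prod_{a'\neq a}\Sigma_{a'}$. An element $\gamma\in\Sigma_{-a}$ is also regarded as the subset $\prod_{a'\ne a}\gamma_{a'}$ of $S_{-a}$. For $\sigma\in\Sigma$, $\sigma_a$ and $\sigma_{-a}$ are its projections on $\Sigma_a$ and $\Sigma_{-a}$. Each $s\in S_a$ is regarded as the function $S_{-a}\to Oc$, $c\mapsto P(c;s)$, where $c;s$ is the profile in which $a$ plays $s$ and the others play $c$. For $s,s'\in S_a$ and $C\subseteq S_{-a}$, writing $\unlhd_a$ for the reflexive closure of $\lhd_a$, $s\lhd_a^{C}s'$ means: for all $c\in C$, $P(c;s)\unlhd_a P(c;s')$, and there is $c\in C$ with $P(c;s)\lhd_a P(c;s')$. A non deterministic best response (ndbr) multi strategic game (with a single index, as here) is a pair $\langle (S_a)_{a\in A},(BR_a)_{a\in A}\rangle$ where each $BR_a$ is a function from $\Sigma_{-a}$ to $\Sigma_a$.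
   Formalization: Each strategy set S_a is additionally assumed finite; without this the claim fails (one agent, S_a = Oc = ℕ, P the identity, usual order <: every BR_a(γ) is empty). The set of agents and the set of outcomes may be infinite. *)

theory Defs
  imports "HOL-Library.FuncSet"
begin

text \<open>
  Strategies of all agents live in one type \<open>'s\<close>, agent \<open>a\<close> owning the set \<open>S a\<close>.
  Products over agents are extensional dependent function sets, so a family indexed by
  \<open>A - {a}\<close> is a function that is \<open>undefined\<close> at \<open>a\<close>, and \<open>c(a := s)\<close> is the profile in
  which \<open>a\<close> plays \<open>s\<close> and the others play \<open>c\<close>.  A pair \<open>(x, y) \<in> pref a\<close> means
  that \<open>a\<close> prefers \<open>y\<close> over \<open>x\<close>.
\<close>

definition abstract_strategic_game ::
  "'a set \<Rightarrow> ('a \<Rightarrow> 's set) \<Rightarrow> 'o set \<Rightarrow> (('a \<Rightarrow> 's) \<Rightarrow> 'o) \<Rightarrow> ('a \<Rightarrow> 'o rel) \<Rightarrow> bool"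
  where
  "abstract_strategic_game A S Oc P pref \<longleftrightarrow>
     A \<noteq> {} \<and> (\<forall>a\<in>A. S a \<noteq> {}) \<and> P \<in> (\<Pi>\<^sub>E a\<in>A. S a) \<rightarrow> Oc \<and> (\<forall>a\<in>A. pref a \<subseteq> Oc \<times> Oc)"

definition opponent_profiles :: "'a set \<Rightarrow> ('a \<Rightarrow> 's set) \<Rightarrow> 'a \<Rightarrow> ('a \<Rightarrow> 's) set"
  where "opponent_profiles A S a = (\<Pi>\<^sub>E b\<in>A - {a}. S b)"

definition nd_strategies :: "('a \<Rightarrow> 's set) \<Rightarrow> 'a \<Rightarrow> 's set set"
  where "nd_strategies S a = Pow (S a) - {{}}"

definition nd_profiles :: "'a set \<Rightarrow> ('a \<Rightarrow> 's set) \<Rightarrow> ('a \<Rightarrow> 's set) set"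
  where "nd_profiles A S = (\<Pi>\<^sub>E a\<in>A. nd_strategies S a)"

definition nd_opponent_profiles :: "'a set \<Rightarrow> ('a \<Rightarrow> 's set) \<Rightarrow> 'a \<Rightarrow> ('a \<Rightarrow> 's set) set"
  where "nd_opponent_profiles A S a = (\<Pi>\<^sub>E b\<in>A - {a}. nd_strategies S b)"

definition dominated_on ::
  "(('a \<Rightarrow> 's) \<Rightarrow> 'o) \<Rightarrow> ('a \<Rightarrow> 'o rel) \<Rightarrow> 'a \<Rightarrow> ('a \<Rightarrow> 's) set \<Rightarrow> 's \<Rightarrow> 's \<Rightarrow> bool"
  where
  "dominated_on P pref a C s s' \<longleftrightarrow>
     (\<forall>c\<in>C. (P (c(a := s)), P (c(a := s'))) \<in> (pref a)\<^sup>=) \<and>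
     (\<exists>c\<in>C. (P (c(a := s)), P (c(a := s'))) \<in> pref a)"

text \<open>
  A nondeterministic opponent profile \<open>\<gamma>\<close>, seen as a set of opponent profiles, is
  \<open>opponent_profiles A \<gamma> a\<close>.
\<close>

definition best_responses ::
  "'a set \<Rightarrow> ('a \<Rightarrow> 's set) \<Rightarrow> (('a \<Rightarrow> 's) \<Rightarrow> 'o) \<Rightarrow> ('a \<Rightarrow> 'o rel) \<Rightarrow>
   'a \<Rightarrow> ('a \<Rightarrow> 's set) \<Rightarrow> 's set"
  where
  "best_responses A S P pref a \<gamma> =
     {s \<in> S a.
        (\<forall>s'\<in>S a. \<not> dominated_on P pref a (opponent_profiles A S a) s s') \<and>
        (\<forall>s'\<in>S a. \<not> dominated_on P pref a (opponent_profiles A \<gamma> a) s s') \<and>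
        (\<exists>c\<in>opponent_profiles A \<gamma> a. \<forall>s'\<in>S a. \<not> dominated_on P pref a {c} s s')}"

definition ndbr_multi_strategic_game ::
  "'a set \<Rightarrow> ('a \<Rightarrow> 's set) \<Rightarrow> ('a \<Rightarrow> ('a \<Rightarrow> 's set) \<Rightarrow> 's set) \<Rightarrow> bool"
  where
  "ndbr_multi_strategic_game A S BR \<longleftrightarrow>
     (\<forall>a\<in>A. BR a \<in> nd_opponent_profiles A S a \<rightarrow> nd_strategies S a)"

definition ndbr_equilibrium ::
  "'a set \<Rightarrow> ('a \<Rightarrow> 's set) \<Rightarrow> ('a \<Rightarrow> ('a \<Rightarrow> 's set) \<Rightarrow> 's set) \<Rightarrow> ('a \<Rightarrow> 's set) \<Rightarrow> bool"
  where
  "ndbr_equilibrium A S BR \<sigma> \<longleftrightarrow>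
     \<sigma> \<in> nd_profiles A S \<and> (\<forall>a\<in>A. \<sigma> a \<subseteq> BR a (restrict \<sigma> (A - {a})))"

end

theory Submission
  imports Defs
begin

text \<open>
  For a chain of sets of opponent profiles, being dominated on some member of the chain is again a
  strict partial order, because domination on the larger of two sets can only weaken to \<open>\<unlhd>\<close> on the
  smaller one.  Hence in a finite strategy set some strategy is undominated on all members at once.
  Applied to the full set, a decreasing chain of nondeterministic profiles and a singleton
  below them, this yields a common best response to the whole chain, and in particular
  \<open>BR\<^sub>a(\<gamma>) \<noteq> {}\<close>.

  An equilibrium is then the end of a transfinite iterated elimination, obtained by Zorn's lemma:
  among the chains \<open>T\<close> of profiles for which the common responses to \<open>T\<close> lie below every member
  of \<open>T\<close>, take a maximal one.  Its profile of common responses may be added to it, hence already is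
  a member, and so consists of responses to itself.
\<close>

text \<open>A family of subsets of a finite set is finite, so a nonempty one has a minimal member,
  and in a chain this member lies inside all others. The factor \<open>X\<close> covers the empty
  family, whose intersection is \<open>UNIV\<close>.\<close>

lemma finite_chain_Inter_nonempty:
  assumes "finite X" and "X \<noteq> {}"
    and sub: "\<And>M. M \<in> \<M> \<Longrightarrow> M \<subseteq> X \<and> M \<noteq> {}"
    and chain: "\<And>M N. M \<in> \<M> \<Longrightarrow> N \<in> \<M> \<Longrightarrow> M \<subseteq> N \<or> N \<subseteq> M"
  shows "X \<inter> \<Inter>\<M> \<noteq> {}"
proof (cases "\<M> = {}")
  case True
  then show ?thesis using assms(2) by simp
next
  case False
  have "finite \<M>"
    using sub by (intro finite_subset[OF _ finite_Pow_iff[THEN iffD2, OF \<open>finite X\<close>]]) blast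
  then obtain M where M: "M \<in> \<M>" "\<forall>N\<in>\<M>. N \<subseteq> M \<longrightarrow> M = N"
    using finite_has_minimal[OF _ False] by blast
  then have "M \<subseteq> X \<inter> \<Inter>\<M>"
    using sub[OF M(1)] chain[OF M(1)] by blast
  then show ?thesis using sub[OF M(1)] by blast
qed

text \<open>Compose on the smaller of \<open>C\<close> and \<open>D\<close>: both dominations give
  weak preference there, and the one stated for that very set supplies a point of strict
  preference.\<close>

lemma dominated_on_trans:
  assumes "trans (pref a)" and "C \<subseteq> D \<or> D \<subseteq> C"
    and "dominated_on P pref a C s t" and "dominated_on P pref a D t u"
  shows "dominated_on P pref a C s u \<or> dominated_on P pref a D s u"
proof -
  have le: "(x, z) \<in> (pref a)\<^sup>=" if "(x, y) \<in> (pref a)\<^sup>=" "(y, z) \<in> (pref a)\<^sup>=" for x y z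
    using that \<open>trans (pref a)\<close> by (auto dest: transD)
  have lt: "(x, z) \<in> pref a"
    if "(x, y) \<in> (pref a)\<^sup>= \<and> (y, z) \<in> pref a \<or> (x, y) \<in> pref a \<and> (y, z) \<in> (pref a)\<^sup>=" for x y z
    using that \<open>trans (pref a)\<close> by (auto dest: transD)
  have on: "dominated_on P pref a E s u" if "E \<subseteq> C" "E \<subseteq> D" "E = C \<or> E = D" for E
  proof -
    have "(P (c(a := s)), P (c(a := t))) \<in> (pref a)\<^sup>= \<and> (P (c(a := t)), P (c(a := u))) \<in> (pref a)\<^sup>="
      if "c \<in> E" for c
      using that \<open>E \<subseteq> C\<close> \<open>E \<subseteq> D\<close> assms(3,4) unfolding dominated_on_def by blast
    moreover have "\<exists>c\<in>E. (P (c(a := s)), P (c(a := t))) \<in> pref a \<or> (P (c(a := t)), P (c(a := u))) \<in> pref a"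
      using \<open>E = C \<or> E = D\<close> assms(3,4) unfolding dominated_on_def by blast
    ultimately show ?thesis
      unfolding dominated_on_def using le lt by (intro conjI ballI; blast)
  qed
  from assms(2) show ?thesis
  proof
    assume "C \<subseteq> D"
    then show ?thesis using on[of C] by blast
  next
    assume "D \<subseteq> C"
    then show ?thesis using on[of D] by blast
  qed
qed

lemma not_dominated_on_self: "irrefl (pref a) \<Longrightarrow> \<not> dominated_on P pref a C s s"
  by (auto simp: dominated_on_def irrefl_def)

lemma exists_undominated_on_chain:
  assumes "irrefl (pref a)" and "trans (pref a)" and "finite X" and "X \<noteq> {}"
    and chain: "\<And>C D. C \<in> \<C> \<Longrightarrow> D \<in> \<C> \<Longrightarrow> C \<subseteq> D \<or> D \<subseteq> C"
  shows "\<exists>s\<in>X. \<forall>C\<in>\<C>. \<forall>t\<in>X. \<not> dominated_on P pref a C s t"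
proof -
  \<comment> \<open>Treating each \<open>C\<close> separately could produce different strategies. A
    maximal element of the union of all these dominations serves every \<open>C\<close> at
    once.\<close>
  define r where "r s t \<longleftrightarrow> (\<exists>C\<in>\<C>. dominated_on P pref a C s t)" for s t
  have r_trans: "r s u" if rst: "r s t" "r t u" for s t u
  proof -
    obtain C D where "C \<in> \<C>" "D \<in> \<C>" "dominated_on P pref a C s t" "dominated_on P pref a D t u"
      using rst unfolding r_def by blast
    then show ?thesis
      using dominated_on_trans[where pref = pref and a = a and C = C and D = D, OF assms(2) chain]
      unfolding r_def by blast
  qed
  have "transp_on X r"
    by (intro transp_onI) (rule r_trans)
  moreover have r_irrefl: "\<not> r s s" for s
    unfolding r_def by (simp add: not_dominated_on_self assms(1))
  then have "asymp_on X r"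
    by (intro asymp_onI) (blast dest: r_trans)
  ultimately obtain s where "s \<in> X" "\<forall>t\<in>X. t \<noteq> s \<longrightarrow> \<not> r s t"
    using Finite_Set.bex_max_element[OF \<open>finite X\<close> _ _ \<open>X \<noteq> {}\<close>, of r] by blast
  with r_irrefl have "\<forall>t\<in>X. \<not> r s t"
    by metis
  with \<open>s \<in> X\<close> show ?thesis unfolding r_def by blast
qed

lemma opponent_profiles_mono:
  "(\<And>b. b \<in> A - {a} \<Longrightarrow> \<sigma> b \<subseteq> \<tau> b) \<Longrightarrow> opponent_profiles A \<sigma> a \<subseteq> opponent_profiles A \<tau> a"
  unfolding opponent_profiles_def by (rule PiE_mono)

lemma opponent_profiles_restrict:
  "opponent_profiles A (restrict \<sigma> (A - {a})) a = opponent_profiles A \<sigma> a"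
  unfolding opponent_profiles_def by (rule PiE_cong) simp

text \<open>Each clause of \<open>best_responses\<close> asks for undominatedness on one set: the
  full product, the product of \<gamma>, or a singleton in it. Since \<open>c\<close> lies in all
  the products, these sets form a single chain, and \<open>{c}\<close> witnesses the last clause for
  every \<gamma> simultaneously.\<close>

lemma exists_common_best_response:
  assumes "irrefl (pref a)" and "trans (pref a)" and "finite (S a)" and "S a \<noteq> {}"
    and chain: "\<And>\<gamma> \<delta>. \<gamma> \<in> \<Gamma> \<Longrightarrow> \<delta> \<in> \<Gamma> \<Longrightarrow>
      opponent_profiles A \<gamma> a \<subseteq> opponent_profiles A \<delta> a \<or>
      opponent_profiles A \<delta> a \<subseteq> opponent_profiles A \<gamma> a"
    and sub: "\<And>\<gamma>. \<gamma> \<in> \<Gamma> \<Longrightarrow> opponent_profiles A \<gamma> a \<subseteq> opponent_profiles A S a"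
    and "c \<in> opponent_profiles A S a" and c: "\<And>\<gamma>. \<gamma> \<in> \<Gamma> \<Longrightarrow> c \<in> opponent_profiles A \<gamma> a"
  shows "\<exists>s\<in>S a. \<forall>\<gamma>\<in>\<Gamma>. s \<in> best_responses A S P pref a \<gamma>"
proof -
  define \<C> where
    "\<C> = insert {c} (insert (opponent_profiles A S a) ((\<lambda>\<gamma>. opponent_profiles A \<gamma> a) ` \<Gamma>))"
  have "C \<subseteq> D \<or> D \<subseteq> C" if "C \<in> \<C>" "D \<in> \<C>" for C D
    using that chain sub assms(7) c unfolding \<C>_def by auto
  from exists_undominated_on_chain[where pref = pref and a = a and P = P and \<C> = \<C>, OF assms(1-4) this]
  obtain s where "s \<in> S a" "\<forall>C\<in>\<C>. \<forall>t\<in>S a. \<not> dominated_on P pref a C s t"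
    by blast
  then have "\<forall>\<gamma>\<in>\<Gamma>. s \<in> best_responses A S P pref a \<gamma>"
    using c unfolding \<C>_def best_responses_def by auto
  with \<open>s \<in> S a\<close> show ?thesis ..
qed

text \<open>Intersecting with \<open>S a\<close> makes the responses to the empty \<open>T\<close>
  the full profile, from which elimination starts.\<close>

definition common_responses ::
  "'a set \<Rightarrow> ('a \<Rightarrow> 's set) \<Rightarrow> ('a \<Rightarrow> ('a \<Rightarrow> 's set) \<Rightarrow> 's set) \<Rightarrow> ('a \<Rightarrow> 's set) set \<Rightarrow> 'a \<Rightarrow> 's set"
  where "common_responses A S BR T = (\<lambda>a\<in>A. S a \<inter> (\<Inter>\<tau>\<in>T. BR a (restrict \<tau> (A - {a}))))"

text \<open>The last clause is the invariant that lets the chain be extended downwards by its own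
  common responses.\<close>

definition elimination_chain ::
  "'a set \<Rightarrow> ('a \<Rightarrow> 's set) \<Rightarrow> ('a \<Rightarrow> ('a \<Rightarrow> 's set) \<Rightarrow> 's set) \<Rightarrow> ('a \<Rightarrow> 's set) set \<Rightarrow> bool"
  where
  "elimination_chain A S BR T \<longleftrightarrow>
     T \<subseteq> nd_profiles A S \<and>
     (\<forall>\<sigma>\<in>T. \<forall>\<tau>\<in>T. (\<forall>a\<in>A. \<sigma> a \<subseteq> \<tau> a) \<or> (\<forall>a\<in>A. \<tau> a \<subseteq> \<sigma> a)) \<and>
     (\<forall>\<tau>\<in>T. \<forall>a\<in>A. common_responses A S BR T a \<subseteq> \<tau> a)"

lemma elimination_chain_Union:
  assumes "subset.chain {T. elimination_chain A S BR T} \<K>"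
  shows "elimination_chain A S BR (\<Union>\<K>)"
proof -
  have good: "elimination_chain A S BR T" if "T \<in> \<K>" for T
    using assms that unfolding subset_chain_def by blast
  have "(\<forall>a\<in>A. \<sigma> a \<subseteq> \<tau> a) \<or> (\<forall>a\<in>A. \<tau> a \<subseteq> \<sigma> a)"
    if \<sigma>\<tau>: "\<sigma> \<in> \<Union>\<K>" "\<tau> \<in> \<Union>\<K>" for \<sigma> \<tau>
  proof -
    obtain U V where "U \<in> \<K>" "\<sigma> \<in> U" "V \<in> \<K>" "\<tau> \<in> V"
      using \<sigma>\<tau> by blast
    moreover from this have "U \<subseteq> V \<or> V \<subseteq> U"
      using assms unfolding subset_chain_def by blast
    ultimately obtain T where "T \<in> \<K>" "\<sigma> \<in> T" "\<tau> \<in> T"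
      by blast
    then show ?thesis using good[of T] unfolding elimination_chain_def by simp
  qed
  moreover have "common_responses A S BR (\<Union>\<K>) a \<subseteq> \<tau> a" if \<tau>: "\<tau> \<in> \<Union>\<K>" and "a \<in> A" for \<tau> a
  proof -
    obtain T where T: "T \<in> \<K>" "\<tau> \<in> T" using \<tau> by blast
    \<comment> \<open>More profiles to respond to leave fewer common responses, so the invariant
      passes from \<open>T\<close> to the union.\<close>
    have "common_responses A S BR (\<Union>\<K>) a \<subseteq> common_responses A S BR T a"
      using T(1) \<open>a \<in> A\<close> by (auto simp: common_responses_def)
    also have "\<dots> \<subseteq> \<tau> a"
      using good[OF T(1)] T(2) \<open>a \<in> A\<close> unfolding elimination_chain_def by simp
    finally show ?thesis .
  qed
  moreover have "\<Union>\<K> \<subseteq> nd_profiles A S"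
    using good unfolding elimination_chain_def by (intro Union_least) simp
  ultimately show ?thesis unfolding elimination_chain_def by simp
qed

lemma elimination_chain_insert:
  assumes "elimination_chain A S BR T" and "common_responses A S BR T \<in> nd_profiles A S"
  shows "elimination_chain A S BR (insert (common_responses A S BR T) T)"
proof -
  define \<rho> where "\<rho> = common_responses A S BR T"
  have "common_responses A S BR (insert \<rho> T) a \<subseteq> \<rho> a" if "a \<in> A" for a
    using that by (auto simp: \<rho>_def common_responses_def)
  moreover have below: "\<rho> a \<subseteq> \<tau> a" if "\<tau> \<in> T" "a \<in> A" for \<tau> a
    using assms(1) that unfolding elimination_chain_def \<rho>_def by simp
  ultimately have "common_responses A S BR (insert \<rho> T) a \<subseteq> \<tau> a"
    if "\<tau> \<in> insert \<rho> T" "a \<in> A" for \<tau> a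
    using that by (metis insertE subset_trans)
  then show ?thesis
    using assms below unfolding elimination_chain_def \<rho>_def[symmetric] by simp
qed

text \<open>The preferences enter only through \<open>nonempty\<close>. Zorn's lemma replaces
  step-by-step elimination because \<open>A\<close> may be infinite, so that finitely many rounds
  need not suffice.\<close>

lemma exists_ndbr_equilibrium:
  assumes nonempty: "\<And>T. elimination_chain A S BR T \<Longrightarrow> common_responses A S BR T \<in> nd_profiles A S"
  shows "\<exists>\<sigma>. ndbr_equilibrium A S BR \<sigma>"
proof -
  obtain T where T: "elimination_chain A S BR T"
    and max: "\<And>U. elimination_chain A S BR U \<Longrightarrow> T \<subseteq> U \<Longrightarrow> U = T"
    using subset_Zorn'[of "{T. elimination_chain A S BR T}"]
    by (metis (no_types, lifting) elimination_chain_Union mem_Collect_eq)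
  define \<sigma> where "\<sigma> = common_responses A S BR T"
  have "\<sigma> \<in> T"
    using max[OF elimination_chain_insert[OF T nonempty[OF T]]] unfolding \<sigma>_def by blast
  then have "\<sigma> a \<subseteq> BR a (restrict \<sigma> (A - {a}))" if "a \<in> A" for a
    using that unfolding \<sigma>_def common_responses_def by auto
  then show ?thesis
    using nonempty[OF T] unfolding \<sigma>_def ndbr_equilibrium_def by blast
qed

theorem lemma26:
  fixes A :: "'a set"
    and S :: "'a \<Rightarrow> 's set"
    and Oc :: "'o set"
    and P :: "('a \<Rightarrow> 's) \<Rightarrow> 'o"
    and pref :: "'a \<Rightarrow> 'o rel"
  assumes "abstract_strategic_game A S Oc P pref"
    and "\<And>a. a \<in> A \<Longrightarrow> irrefl (pref a) \<and> trans (pref a)"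
    and "\<And>a. a \<in> A \<Longrightarrow> finite (S a)"
  shows "ndbr_multi_strategic_game A S (best_responses A S P pref) \<and>
         (\<exists>\<sigma>. ndbr_equilibrium A S (best_responses A S P pref) \<sigma>)"
proof
  let ?BR = "best_responses A S P pref"
  have S: "S a \<noteq> {}" if "a \<in> A" for a
    using assms(1) that unfolding abstract_strategic_game_def by blast
  show "ndbr_multi_strategic_game A S ?BR"
    unfolding ndbr_multi_strategic_game_def
  proof (intro ballI funcsetI)
    fix a \<gamma> assume a: "a \<in> A" and \<gamma>: "\<gamma> \<in> nd_opponent_profiles A S a"
    have \<gamma>b: "\<gamma> b \<subseteq> S b" "\<gamma> b \<noteq> {}" if "b \<in> A - {a}" for b
      using PiE_mem[OF \<gamma>[unfolded nd_opponent_profiles_def] that] by (auto simp: nd_strategies_def)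
    have sub: "opponent_profiles A \<gamma> a \<subseteq> opponent_profiles A S a"
      using \<gamma>b by (intro opponent_profiles_mono)
    obtain c where c: "c \<in> opponent_profiles A \<gamma> a"
      using \<gamma>b unfolding opponent_profiles_def by (metis PiE_eq_empty_iff all_not_in_conv)
    \<comment> \<open>With one profile the chain is just \<open>{c}\<close>, the product of
      \<gamma>, and the full product.\<close>
    have "\<exists>s\<in>S a. \<forall>\<delta>\<in>{\<gamma>}. s \<in> ?BR a \<delta>"
      using assms(2)[OF a] assms(3)[OF a] S[OF a] sub c
      by (intro exists_common_best_response[where c = c]) auto
    then show "?BR a \<gamma> \<in> nd_strategies S a"
      by (auto simp: nd_strategies_def best_responses_def)
  qed
  show "\<exists>\<sigma>. ndbr_equilibrium A S ?BR \<sigma>"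
  proof (rule exists_ndbr_equilibrium)
    fix T assume T: "elimination_chain A S ?BR T"
    have Tb: "\<tau> b \<subseteq> S b \<and> \<tau> b \<noteq> {}" if "\<tau> \<in> T" "b \<in> A" for \<tau> b
      using T that PiE_mem[of \<tau> A "nd_strategies S" b]
      unfolding elimination_chain_def nd_profiles_def by (auto simp: nd_strategies_def)
    have chain: "(\<forall>a\<in>A. \<sigma> a \<subseteq> \<tau> a) \<or> (\<forall>a\<in>A. \<tau> a \<subseteq> \<sigma> a)" if "\<sigma> \<in> T" "\<tau> \<in> T" for \<sigma> \<tau>
      using T that unfolding elimination_chain_def by blast
    have "common_responses A S ?BR T a \<in> nd_strategies S a" if a: "a \<in> A" for a
    proof -
      \<comment> \<open>Finiteness of \<open>S b\<close> is used coordinate by coordinate; choosing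
        a point in every coordinate then gives an opponent profile \<open>c\<close> inside all
        members of \<open>T\<close>.\<close>
      have "S b \<inter> \<Inter>((\<lambda>\<tau>. \<tau> b) ` T) \<noteq> {}" if b: "b \<in> A" for b
      proof (rule finite_chain_Inter_nonempty[OF assms(3)[OF b] S[OF b]])
        fix M N assume "M \<in> (\<lambda>\<tau>. \<tau> b) ` T" "N \<in> (\<lambda>\<tau>. \<tau> b) ` T"
        then show "M \<subseteq> N \<or> N \<subseteq> M" using chain b by blast
      qed (use Tb b in auto)
      then have "opponent_profiles A (\<lambda>b. S b \<inter> (\<Inter>\<tau>\<in>T. \<tau> b)) a \<noteq> {}"
        unfolding opponent_profiles_def by (simp add: PiE_eq_empty_iff)
      then obtain c where c: "c \<in> opponent_profiles A (\<lambda>b. S b \<inter> (\<Inter>\<tau>\<in>T. \<tau> b)) a"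
        by blast
      \<comment> \<open>\<open>BR a\<close> is applied to profiles cut down to the opponents of
        \<open>a\<close>; the cut leaves their products unchanged.\<close>
      define \<Gamma> where "\<Gamma> = (\<lambda>\<tau>. restrict \<tau> (A - {a})) ` T"
      have "\<exists>s\<in>S a. \<forall>\<gamma>\<in>\<Gamma>. s \<in> ?BR a \<gamma>"
      proof (rule exists_common_best_response[where c = c])
        show "c \<in> opponent_profiles A S a"
          by (rule subsetD[OF opponent_profiles_mono c]) blast
      next
        fix \<gamma> assume "\<gamma> \<in> \<Gamma>"
        then obtain \<tau> where \<tau>: "\<tau> \<in> T" "opponent_profiles A \<gamma> a = opponent_profiles A \<tau> a"
          unfolding \<Gamma>_def by (auto simp: opponent_profiles_restrict)
        show "c \<in> opponent_profiles A \<gamma> a"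
          unfolding \<tau>(2) by (rule subsetD[OF opponent_profiles_mono c]) (use \<tau>(1) in blast)
        show "opponent_profiles A \<gamma> a \<subseteq> opponent_profiles A S a"
          unfolding \<tau>(2) using Tb[OF \<tau>(1)] by (intro opponent_profiles_mono) blast
      next
        fix \<gamma> \<delta> assume "\<gamma> \<in> \<Gamma>" "\<delta> \<in> \<Gamma>"
        then obtain \<sigma> \<tau> where "\<sigma> \<in> T" "opponent_profiles A \<gamma> a = opponent_profiles A \<sigma> a"
          "\<tau> \<in> T" "opponent_profiles A \<delta> a = opponent_profiles A \<tau> a"
          unfolding \<Gamma>_def by (auto simp: opponent_profiles_restrict)
        \<comment> \<open>Members of \<open>T\<close> compare in the same direction for all agents,
          hence their products are nested.\<close>
        then show "opponent_profiles A \<gamma> a \<subseteq> opponent_profiles A \<delta> a \<or>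
            opponent_profiles A \<delta> a \<subseteq> opponent_profiles A \<gamma> a"
          using chain[of \<sigma> \<tau>] opponent_profiles_mono[of A a \<sigma> \<tau>] opponent_profiles_mono[of A a \<tau> \<sigma>]
          by auto
      qed (use assms(2,3) S a in auto)
      then show ?thesis
        using a unfolding \<Gamma>_def common_responses_def nd_strategies_def by auto
    qed
    then show "common_responses A S ?BR T \<in> nd_profiles A S"
      unfolding nd_profiles_def common_responses_def by (simp add: PiE_iff)
  qed
qed

end
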